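(* Let $x^*\in\mathbb{R}^n$ be a second-order stationary point of the problem $\min_{x\in\mathbb{R}^n}\{F(x)=f(x)+\lambda\|x\|_p^p\}$, and let $\mathcal{B}=\{i: x^*_i\neq 0\}$. Suppose that $f$ is twice continuously differentiable in a neighborhood of $x^*$. Then $$|x^*_i|\ \ge\ \left(\frac{\lambda p(1-p)}{L_f}\right)^{\frac{1}{2-p}},\qquad \forall i\in\mathcal{B}.$$
   Context: Here $\lambda>0$, $p\in(0,1)$, and $f:\mathbb{R}^n\to\mathbb{R}$ is a continuously differentiable function, bounded below on $\mathbb{R}^n$, whose gradient is $L_f$-Lipschitz continuous with $L_f>0$: $\|\nabla f(x)-\nabla f(y)\|_2\le L_f\|x-y\|_2$ for all $x,y\in\mathbb{R}^n$. Also $\|x\|_p^p=\sum_{i=1}^n|x_i|^p$. For $x\in\mathbb{R}^n$, $|x|^p$ is the vector with components $|x_i|^p$ and $\mathrm{Diag}(x)$ is the diagonal matrix with diagonal $x$. A vector $x^*$ (with $X^*=\mathrm{Diag}(x^* )$, $f$ twice differentiable at $x^*$) is a second-order stationary point of the problem if the matrix $(X^* )^T\nabla^2 f(x^* )X^*+\lambda p(p-1)\mathrm{Diag}(|x^*|^p)$ is positive semidefinite. *)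

theory Defs
  imports "HOL-Analysis.Analysis"
begin

definition gradient :: "(real^'n \<Rightarrow> real) \<Rightarrow> real^'n \<Rightarrow> real^'n" where
  "gradient f x = (\<chi> i. frechet_derivative f (at x) (axis i 1))"

lemma gradient_eq_gderiv:
  fixes f :: "real^'n \<Rightarrow> real"
  assumes "GDERIV f x :> D"
  shows "gradient f x = D"
proof -
  have "(f has_derivative (\<lambda>h. inner h D)) (at x)"
    using assms by (simp add: gderiv_def)
  then have "frechet_derivative f (at x) = (\<lambda>h. inner h D)"
    by (metis frechet_derivative_at)
  then show ?thesis
    by (simp add: gradient_def vec_eq_iff inner_axis')
qed

text \<open>The entry of the Hessian in row \<open>i\<close> and column \<open>j\<close> is the \<open>j\<close>-th partial derivative
  of the \<open>i\<close>-th partial derivative. Like \<^const>\<open>gradient\<close>, it is meaningful only where the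
  derivatives involved exist.\<close>

definition hessian :: "(real^'n \<Rightarrow> real) \<Rightarrow> real^'n \<Rightarrow> real^'n^'n" where
  "hessian f x = jacobian (gradient f) (at x)"

definition twice_differentiable_at :: "(real^'n \<Rightarrow> real) \<Rightarrow> real^'n \<Rightarrow> bool" where
  "twice_differentiable_at f x \<longleftrightarrow>
     (\<forall>\<^sub>F y in nhds x. f differentiable (at y)) \<and> gradient f differentiable (at x)"

definition twice_continuously_differentiable_near :: "(real^'n \<Rightarrow> real) \<Rightarrow> real^'n \<Rightarrow> bool" where
  "twice_continuously_differentiable_near f x \<longleftrightarrow>
     (\<exists>U. open U \<and> x \<in> U \<and> (\<forall>y\<in>U. twice_differentiable_at f y) \<and> continuous_on U (hessian f))"

definition diag_matrix :: "real^'n \<Rightarrow> real^'n^'n" where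
  "diag_matrix v = (\<chi> i j. if i = j then v $ i else 0)"

definition positive_semidefinite :: "real^'n^'n \<Rightarrow> bool" where
  "positive_semidefinite A \<longleftrightarrow> transpose A = A \<and> (\<forall>v. 0 \<le> inner v (A *v v))"

text \<open>Second-order stationarity for the problem of minimising
  \<open>f x + lam * (\<Sum>i\<in>UNIV. \<bar>x $ i\<bar> powr p)\<close>. Although this objective need not be differentiable
  where a coordinate vanishes, multiplying by \<open>Diag(x)\<close> on both sides makes the condition
  meaningful at every \<open>x\<close>; note that \<open>0 powr p = 0\<close>.\<close>

definition second_order_stationary ::
    "(real^'n \<Rightarrow> real) \<Rightarrow> real \<Rightarrow> real \<Rightarrow> real^'n \<Rightarrow> bool" where
  "second_order_stationary f lam p x \<longleftrightarrow>
     twice_differentiable_at f x \<and>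
     positive_semidefinite
       (transpose (diag_matrix x) ** hessian f x ** diag_matrix x
        + (lam * p * (p - 1)) *\<^sub>R diag_matrix (\<chi> i. \<bar>x $ i\<bar> powr p))"

end

theory Submission
  imports Defs
begin

text \<open>The derivative of an \<open>L\<^sub>f\<close>-Lipschitz gradient has operator norm at most \<open>L\<^sub>f\<close>. Testing
  semidefiniteness on the \<open>i\<close>-th unit vector therefore gives
  \<open>lam * p * (1 - p) * \<bar>xs $ i\<bar> powr p \<le> L\<^sub>f * \<bar>xs $ i\<bar>\<^sup>2\<close>, and for \<open>xs $ i \<noteq> 0\<close> one divides by
  \<open>\<bar>xs $ i\<bar> powr p\<close>.\<close>

text \<open>Along the line \<open>x + t *\<^sub>R v\<close> the difference quotients of
  \<open>g\<close> tend to \<open>g' v\<close>. Each has norm at most \<open>L * norm v\<close>, and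
  the bound passes to the limit.\<close>

lemma norm_derivative_le_Lipschitz:
  fixes g :: "'a::real_normed_vector \<Rightarrow> 'b::real_normed_vector"
  assumes deriv: "(g has_derivative g') (at x)"
    and lip: "\<And>y. norm (g y - g x) \<le> L * norm (y - x)"
  shows "norm (g' v) \<le> L * norm v"
proof -
  have "((\<lambda>t. x + t *\<^sub>R v) has_derivative (\<lambda>t. t *\<^sub>R v)) (at (0::real))"
    by (auto intro!: derivative_eq_intros)
  moreover have "(g has_derivative g') (at (x + (0::real) *\<^sub>R v))"
    using deriv by simp
  ultimately have "((\<lambda>t. g (x + t *\<^sub>R v)) has_derivative (\<lambda>t. g' (t *\<^sub>R v))) (at (0::real))"
    by (rule has_derivative_compose)
  then have "((\<lambda>t. norm (g (x + t *\<^sub>R v) - g x - t *\<^sub>R g' v) / \<bar>t\<bar>) \<longlongrightarrow> 0) (at 0)"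
    using linear_scale[OF has_derivative_linear[OF deriv]] by (simp add: has_derivative_at)
  \<comment> \<open>Linearity has turned \<open>g' (t *\<^sub>R v)\<close> into
    \<open>t *\<^sub>R g' v\<close>, so dividing by \<open>t\<close> inside the norm makes the
    remainder a difference quotient minus its limit.\<close>
  then have "((\<lambda>t. norm ((g (x + t *\<^sub>R v) - g x) /\<^sub>R t - g' v)) \<longlongrightarrow> 0) (at 0)"
  proof (rule Lim_transform_eventually)
    have "norm (g (x + t *\<^sub>R v) - g x - t *\<^sub>R g' v) / \<bar>t\<bar>
        = norm ((g (x + t *\<^sub>R v) - g x) /\<^sub>R t - g' v)" if "t \<noteq> 0" for t
    proof -
      have "(g (x + t *\<^sub>R v) - g x) /\<^sub>R t - g' v = (g (x + t *\<^sub>R v) - g x - t *\<^sub>R g' v) /\<^sub>R t"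
        using that by (simp add: scaleR_diff_right)
      then show ?thesis
        by (simp add: divide_inverse_commute)
    qed
    then show "\<forall>\<^sub>F t in at 0. norm (g (x + t *\<^sub>R v) - g x - t *\<^sub>R g' v) / \<bar>t\<bar>
        = norm ((g (x + t *\<^sub>R v) - g x) /\<^sub>R t - g' v)"
      by (simp add: eventually_at_filter)
  qed
  then have lim: "((\<lambda>t. (g (x + t *\<^sub>R v) - g x) /\<^sub>R t) \<longlongrightarrow> g' v) (at 0)"
    by (rule LIM_zero_cancel[OF tendsto_norm_zero_cancel])
  have "norm ((g (x + t *\<^sub>R v) - g x) /\<^sub>R t) \<le> L * norm v" if "t \<noteq> 0" for t
    using lip[of "x + t *\<^sub>R v"] that by (simp add: divide_simps mult_ac)
  then have "\<forall>\<^sub>F t in at 0. norm ((g (x + t *\<^sub>R v) - g x) /\<^sub>R t) \<le> L * norm v"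
    by (auto simp: eventually_at_filter)
  with lim show ?thesis
    by (intro Lim_norm_ubound[OF _ lim]) auto
qed

lemma diag_matrix_mult_axis: "diag_matrix v *v axis i 1 = (v $ i) *\<^sub>R axis i 1"
  unfolding matrix_vector_mult_basis
  by (simp add: vec_eq_iff column_def diag_matrix_def axis_def)

lemma gradient_has_derivative_hessian:
  assumes "twice_differentiable_at f x"
  shows "(gradient f has_derivative (*v) (hessian f x)) (at x)"
  using assms jacobian_works[of "gradient f" "at x"]
  by (simp add: twice_differentiable_at_def hessian_def)

text \<open>\<open>Diag(x)\<close> scales the \<open>i\<close>-th unit vector by
  \<open>x $ i\<close>, so the tested form is that of the Hessian at \<open>?w\<close> plus the
  diagonal term. Cauchy-Schwarz and the operator norm bound then apply, with \<open>norm ?w\<close>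
  equal to \<open>\<bar>x $ i\<bar>\<close>.\<close>

lemma stationary_coordinate_inequality:
  fixes f :: "real^'n \<Rightarrow> real"
  assumes lip: "\<And>y. norm (gradient f y - gradient f x) \<le> L * norm (y - x)"
    and stat: "second_order_stationary f lam p x"
  shows "lam * p * (1 - p) * \<bar>x $ i\<bar> powr p \<le> L * \<bar>x $ i\<bar>\<^sup>2"
proof -
  let ?e = "axis i 1 :: real^'n" and ?D = "diag_matrix x" and ?H = "hessian f x"
  let ?w = "(x $ i) *\<^sub>R ?e"
  let ?P = "diag_matrix (\<chi> i. \<bar>x $ i\<bar> powr p)"
  have "0 \<le> ?e \<bullet> ((transpose ?D ** ?H ** ?D + (lam * p * (p - 1)) *\<^sub>R ?P) *v ?e)"
    using stat by (simp add: second_order_stationary_def positive_semidefinite_def)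
  also have "\<dots> = ?e \<bullet> ((transpose ?D ** ?H ** ?D) *v ?e)
      + lam * p * (p - 1) * (?e \<bullet> (?P *v ?e))"
    by (simp add: matrix_vector_mult_add_rdistrib inner_add_right
        flip: scaleR_matrix_vector_assoc)
  also have "?e \<bullet> ((transpose ?D ** ?H ** ?D) *v ?e) = ?e \<bullet> ((?H *v ?w) v* ?D)"
    unfolding matrix_vector_mul_assoc[symmetric] diag_matrix_mult_axis transpose_matrix_vector ..
  \<comment> \<open>The left factor \<open>?D\<close> moves across the inner product as an adjoint
    and acts on \<open>?e\<close>.\<close>
  also have "\<dots> = ?w \<bullet> (?H *v ?w)"
    unfolding diag_matrix_mult_axis[symmetric] by (metis dot_lmul_matrix inner_commute)
  also have "?e \<bullet> (?P *v ?e) = \<bar>x $ i\<bar> powr p"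
    by (simp add: diag_matrix_mult_axis)
  \<comment> \<open>The diagonal term changes sides, which turns \<open>p - 1\<close> into
    \<open>1 - p\<close>.\<close>
  finally have "lam * p * (1 - p) * \<bar>x $ i\<bar> powr p \<le> ?w \<bullet> (?H *v ?w)"
    by (simp add: algebra_simps)
  also have "\<dots> \<le> norm ?w * norm (?H *v ?w)"
    by (rule norm_cauchy_schwarz)
  also have "\<dots> \<le> norm ?w * (L * norm ?w)"
    using stat
    by (intro mult_left_mono norm_derivative_le_Lipschitz[OF gradient_has_derivative_hessian lip])
      (auto simp: second_order_stationary_def)
  also have "\<dots> = L * \<bar>x $ i\<bar>\<^sup>2"
    by (simp add: power2_eq_square)
  finally show ?thesis .
qed

lemma powr_lower_bound:
  fixes a c L p :: real
  assumes "a > 0" "L > 0" "p < 2" "c \<ge> 0" and le: "c * a powr p \<le> L * a\<^sup>2"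
  shows "(c / L) powr (1 / (2 - p)) \<le> a"
proof -
  have "a\<^sup>2 = a powr (2 - p) * a powr p"
    using \<open>a > 0\<close> by (simp flip: powr_add)
  with le have "c * a powr p \<le> (L * a powr (2 - p)) * a powr p"
    by (simp add: mult_ac)
  with \<open>a > 0\<close> have "c \<le> L * a powr (2 - p)"
    by simp
  with \<open>L > 0\<close> have "c / L \<le> a powr (2 - p)"
    by (simp add: divide_simps mult_ac)
  \<comment> \<open>The exponent is positive as \<open>p < 2\<close>, and the base is nonnegative as
    \<open>c \<ge> 0\<close>, so the power is monotone here.\<close>
  then have "(c / L) powr (1 / (2 - p)) \<le> (a powr (2 - p)) powr (1 / (2 - p))"
    using assms by (intro powr_mono2) auto
  also have "\<dots> = a"
    using assms by (simp add: powr_powr)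
  finally show ?thesis .
qed

theorem theorem2p2:
  fixes f :: "real^'n \<Rightarrow> real" and lam p L\<^sub>f :: real and xs :: "real^'n"
  assumes "lam > 0" and "0 < p" and "p < 1"
    and "\<And>x. f differentiable (at x)" and "continuous_on UNIV (gradient f)"
    and "bdd_below (range f)"
    and "L\<^sub>f > 0"
    and "\<And>x y. norm (gradient f x - gradient f y) \<le> L\<^sub>f * norm (x - y)"
    and "second_order_stationary f lam p xs"
    and "twice_continuously_differentiable_near f xs"
  shows "\<forall>i\<in>{i. xs $ i \<noteq> 0}. \<bar>xs $ i\<bar> \<ge> (lam * p * (1 - p) / L\<^sub>f) powr (1 / (2 - p))"
proof
  fix i assume "i \<in> {i. xs $ i \<noteq> 0}"
  then show "\<bar>xs $ i\<bar> \<ge> (lam * p * (1 - p) / L\<^sub>f) powr (1 / (2 - p))"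
    \<comment> \<open>Here \<open>a\<close> is \<open>\<bar>xs $ i\<bar>\<close> and
      \<open>c\<close> is \<open>lam * p * (1 - p)\<close>, which is positive because
      \<open>lam > 0\<close> and \<open>0 < p < 1\<close>.\<close>
    using assms(1-3,7) stationary_coordinate_inequality[OF assms(8,9)]
    by (intro powr_lower_bound) auto
qed

end
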